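(* Let $n \geq 1$ be an integer and $g = 2^n$. If $Z \in \mathbb{A}^s_{2^n}$, then the symplectic lattice $P_Z \cdot \mathbb{Z}^{2g}$ has at least $g - 1$ symmetries.
   Context: $\otimes$ denotes the Kronecker product of matrices, and $M^{\otimes k}$ the $k$-fold Kronecker product of $M$ with itself (with $M^{\otimes 0} = (1)$). Let $J_2 = \begin{pmatrix} 0 & 1 \\ 1 & 0 \end{pmatrix}$. For $k \in \{1,\dots,n\}$ let $J_{2^n}^{k} = J_2^{\otimes k} \otimes \mathrm{Id}_2^{\otimes (n-k)} \in M_{2^n}(\mathbb{R})$ (here $k$ is an upper index, not a power). The group $\mathcal{Z}_2^n$ is the multiplicative group of matrices generated by $J_{2^n}^1,\dots,J_{2^n}^n$. It acts on $M_{2^n}(\mathbb{R})$ by conjugation, and its set of fixed points is $\mathrm{Fix}(\mathcal{Z}_2^n) = \{A \in M_{2^n}(\mathbb{R}) \mid J_{2^n}^k A J_{2^n}^k = A \text{ for all } k \in \{1,\dots,n\}\}$ (each $J_{2^n}^k$ is its own inverse). Let $\mathcal{H}_g = \{ Z = X + iY \in M_g(\mathbb{C}) \mid X, Y \in M_g(\mathbb{R}),\ X = X^T,\ Y = Y^T,\ Y > 0 \}$ be Siegel's upper half space ($Y>0$ means positive definite). For $Z = X+iY \in \mathcal{H}_g$ let \[ P_Z = \begin{pmatrix} \sqrt{Y^{-1}} & 0 \\ 0 & \sqrt{Y} \end{pmatrix}\begin{pmatrix} \mathrm{Id}_g & X \\ 0 & \mathrm{Id}_g \end{pmatrix} \in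 M_{2g}(\mathbb{R}), \] where $\sqrt{\cdot}$ denotes the symmetric positive definite square root of a symmetric positive definite matrix. The set $\mathbb{A}^s_{2^n}$ is defined by \[ \mathbb{A}^s_{2^n} = \{ Z = X + iY \in \mathcal{H}_{2^n} \mid \sqrt{Y} \in \mathrm{Fix}(\mathcal{Z}_2^n) \text{ and } X \in \mathrm{Fix}(\mathcal{Z}_2^n) \}. \] A symmetry of a lattice $\Lambda \subset \mathbb{R}^d$ is an orthogonal matrix $O \in O_d(\mathbb{R}) \setminus \{\pm \mathrm{Id}_d\}$ with $O\Lambda = \Lambda$; "at least $g-1$ symmetries" means at least $g-1$ distinct such matrices $O$ (here $d = 2g$). *)

theory Defs
  imports Complex_Main "Jordan_Normal_Form.Gauss_Jordan_Elimination"
begin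

definition kronecker :: "'a::times mat \<Rightarrow> 'a mat \<Rightarrow> 'a mat" where
  "kronecker A B = mat (dim_row A * dim_row B) (dim_col A * dim_col B)
     (\<lambda>(i, j). A $$ (i div dim_row B, j div dim_col B) * B $$ (i mod dim_row B, j mod dim_col B))"

fun kronecker_pow :: "'a::semiring_1 mat \<Rightarrow> nat \<Rightarrow> 'a mat" where
  "kronecker_pow M 0 = 1\<^sub>m 1"
| "kronecker_pow M (Suc k) = kronecker M (kronecker_pow M k)"

definition J2 :: "real mat" where
  "J2 = mat_of_rows_list 2 [[0, 1], [1, 0]]"

(* J n k is J_{2^n}^k, where k is an upper index, not a power; meaningful for k \<le> n *)
definition J :: "nat \<Rightarrow> nat \<Rightarrow> real mat" where
  "J n k = kronecker (kronecker_pow J2 k) (kronecker_pow (1\<^sub>m 2) (n - k))"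

(* Fixed points in M_{2^n}(R) of conjugation by the group Z_2^n generated by J n 1, ..., J n n;
   each J n k is its own inverse. *)
definition Fix_Z2 :: "nat \<Rightarrow> real mat set" where
  "Fix_Z2 n = {A \<in> carrier_mat (2 ^ n) (2 ^ n). \<forall>k \<in> {1..n}. J n k * A * J n k = A}"

(* The symmetry condition also forces A to be square. *)
definition sym_pos_def :: "real mat \<Rightarrow> bool" where
  "sym_pos_def A \<longleftrightarrow> transpose_mat A = A \<and>
     (\<forall>v \<in> carrier_vec (dim_row A). v \<noteq> 0\<^sub>v (dim_row A) \<longrightarrow> v \<bullet> (A *\<^sub>v v) > 0)"

(* Only meaningful for symmetric positive definite A. *)
definition mat_sqrt :: "real mat \<Rightarrow> real mat" where
  "mat_sqrt A = (THE B. sym_pos_def B \<and> B * B = A)"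

definition siegel_space :: "nat \<Rightarrow> complex mat set" where
  "siegel_space g = {map_mat complex_of_real X + \<i> \<cdot>\<^sub>m map_mat complex_of_real Y | X Y.
     X \<in> carrier_mat g g \<and> Y \<in> carrier_mat g g \<and> transpose_mat X = X \<and> sym_pos_def Y}"

(* For Z = X + iY with X, Y real, map_mat Re Z is X and map_mat Im Z is Y. *)
definition P_mat :: "complex mat \<Rightarrow> real mat" where
  "P_mat Z = (let g = dim_row Z; X = map_mat Re Z; Y = map_mat Im Z in
     four_block_mat (mat_sqrt (the (mat_inverse Y))) (0\<^sub>m g g) (0\<^sub>m g g) (mat_sqrt Y) *
     four_block_mat (1\<^sub>m g) X (0\<^sub>m g g) (1\<^sub>m g))"

definition A_s :: "nat \<Rightarrow> complex mat set" where
  "A_s n = {Z \<in> siegel_space (2 ^ n).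
     mat_sqrt (map_mat Im Z) \<in> Fix_Z2 n \<and> map_mat Re Z \<in> Fix_Z2 n}"

definition int_vecs :: "nat \<Rightarrow> real vec set" where
  "int_vecs d = {v \<in> carrier_vec d. \<forall>i < d. v $ i \<in> \<int>}"

definition symplectic_lattice :: "complex mat \<Rightarrow> real vec set" where
  "symplectic_lattice Z = (\<lambda>v. P_mat Z *\<^sub>v v) ` int_vecs (2 * dim_row Z)"

(* The predicate orthogonal_mat of Jordan_Normal_Form only asks for pairwise orthogonal nonzero
   columns, so membership in the orthogonal group is spelled out. *)
definition lattice_symmetries :: "nat \<Rightarrow> real vec set \<Rightarrow> real mat set" where
  "lattice_symmetries d L = {U \<in> carrier_mat d d. transpose_mat U * U = 1\<^sub>m d \<and>
     U \<noteq> 1\<^sub>m d \<and> U \<noteq> - 1\<^sub>m d \<and> (\<lambda>v. U *\<^sub>v v) ` L = L}"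

end

theory Submission
  imports Defs "Jordan_Normal_Form.Determinant"
begin

text \<open>
  The index set of a \<open>2 ^ n\<close>-dimensional matrix is the group of bit strings of length \<open>n\<close>, with
  bitwise exclusive or as addition, and \<open>J n k\<close> is the permutation matrix of the translation by
  the string whose top \<open>k\<close> bits are set (\<open>J_eq\<close>). These strings generate the whole group, so a
  matrix in \<open>Fix_Z2 n\<close> commutes with the permutation matrix \<open>T\<close> of every one of the \<open>2 ^ n\<close>
  translations (\<open>Fix_Z2_commute_translation_mat\<close>).

  Let \<open>Z = X + iY\<close> be in \<open>A_s n\<close>. Then \<open>T\<close> commutes with \<open>X\<close> and with the root of \<open>Y\<close>, hence also
  with the inverse of that root, which is the root of the inverse of \<open>Y\<close>
  (\<open>mat_sqrt_inverse_commute\<close>). Therefore the block diagonal matrix \<open>U\<close> with two blocks \<open>T\<close>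
  commutes with \<open>P_mat Z\<close>. Being a permutation matrix, \<open>U\<close> is orthogonal and preserves the integer
  vectors, so it preserves their image under \<open>P_mat Z\<close>. The \<open>2 ^ n - 1\<close> nontrivial translations give
  distinct matrices \<open>U\<close>, because the first column of \<open>U\<close> shows where the index \<open>0\<close> goes; as it does
  not stay at \<open>0\<close>, \<open>U\<close> is neither the identity nor its negative.
\<close>

section \<open>Translations of the index set\<close>

text \<open>
  The symmetric condition \<open>xor i j = a\<close> says \<open>j = xor i a\<close>, so this is the permutation matrix of
  the translation by \<open>a\<close>. The condition passes bit by bit to Kronecker products.
\<close>

definition translation_mat :: "nat \<Rightarrow> nat \<Rightarrow> 'a::zero_neq_one mat" where
  "translation_mat n a = mat (2 ^ n) (2 ^ n) (\<lambda>(i, j). if xor i j = a then 1 else 0)"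

lemma translation_mat_carrier [simp]: "translation_mat n a \<in> carrier_mat (2 ^ n) (2 ^ n)"
  by (simp add: translation_mat_def)

lemma dim_translation_mat [simp]:
  "dim_row (translation_mat n a) = 2 ^ n" "dim_col (translation_mat n a) = 2 ^ n"
  by (simp_all add: translation_mat_def)

lemma xor_less_power_two:
  fixes a b :: nat
  assumes "a < 2 ^ n" "b < 2 ^ n"
  shows "xor a b < 2 ^ n"
  using assms by (metis take_bit_nat_eq_self_iff take_bit_xor)

lemma xor_eq_iff:
  fixes a b c :: nat
  shows "xor a b = c \<longleftrightarrow> b = xor a c"
proof -
  have "xor a (xor a x) = x" for x :: nat
    by (simp flip: xor.assoc)
  then show ?thesis
    by metis
qed

lemma translation_mat_mult_index:
  fixes M :: "'a::semiring_1 mat"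
  assumes M: "M \<in> carrier_mat (2 ^ n) d" and a: "a < 2 ^ n" and i: "i < 2 ^ n" and j: "j < d"
  shows "(translation_mat n a * M) $$ (i, j) = M $$ (xor i a, j)"
proof -
  have "(translation_mat n a * M) $$ (i, j)
      = (\<Sum>l = 0..<2 ^ n. (if xor i l = a then 1 else 0) * M $$ (l, j))"
    using M i j by (simp add: translation_mat_def scalar_prod_def)
  also have "\<dots> = (\<Sum>l = 0..<2 ^ n. if l = xor i a then M $$ (l, j) else 0)"
    by (intro sum.cong refl) (auto simp: xor_eq_iff)
  also have "\<dots> = M $$ (xor i a, j)"
    using xor_less_power_two[OF i a] by simp
  finally show ?thesis .
qed

lemma translation_mat_mult:
  assumes "a < 2 ^ n" "b < 2 ^ n"
  shows "translation_mat n a * translation_mat n b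
    = (translation_mat n (xor a b) :: 'a::semiring_1 mat)"
proof (rule eq_matI)
  fix i j
  assume "i < dim_row (translation_mat n (xor a b) :: 'a mat)"
    and "j < dim_col (translation_mat n (xor a b) :: 'a mat)"
  then have ij: "i < 2 ^ n" "j < 2 ^ n"
    by simp_all
  have "xor (xor i a) j = b \<longleftrightarrow> xor i j = xor a b"
    by (metis xor.assoc xor.commute xor_eq_iff)
  then show "(translation_mat n a * translation_mat n b) $$ (i, j)
      = (translation_mat n (xor a b) :: 'a mat) $$ (i, j)"
    using ij assms xor_less_power_two[of i n a]
    by (simp add: translation_mat_mult_index[OF translation_mat_carrier] del: index_mult_mat)
      (simp add: translation_mat_def)
qed simp_all

lemma translation_mat_0 [simp]: "translation_mat n 0 = 1\<^sub>m (2 ^ n)"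
  by (rule eq_matI) (auto simp: translation_mat_def xor_eq_iff)

lemma transpose_translation_mat [simp]:
  "transpose_mat (translation_mat n a) = translation_mat n a"
  by (rule eq_matI) (auto simp: translation_mat_def xor.commute)

lemma translation_mat_square:
  "a < 2 ^ n \<Longrightarrow> translation_mat n a * translation_mat n a = (1\<^sub>m (2 ^ n) :: 'a::semiring_1 mat)"
  by (simp add: translation_mat_mult)

lemma translation_mat_column_0:
  assumes "i < 2 ^ n"
  shows "translation_mat n a $$ (i, 0) = (if i = a then 1 else 0)"
  using assms by (simp add: translation_mat_def)

section \<open>The matrices \<open>J\<close> are translations\<close>

text \<open>
  The row \<open>i\<close> of a Kronecker product is addressed by \<open>i div 2 ^ k\<close> and \<open>i mod 2 ^ k\<close>, the high
  and the low bits of \<open>i\<close>, on which the two factors act separately. The strings \<open>a\<close> and \<open>b\<close> are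
  therefore concatenated.
\<close>

lemma kronecker_translation_mat:
  assumes b: "b < 2 ^ k"
  shows "kronecker (translation_mat m a) (translation_mat k b)
    = (translation_mat (m + k) (a * 2 ^ k + b) :: 'a::semiring_1 mat)"
proof (rule eq_matI)
  fix i j
  assume "i < dim_row (translation_mat (m + k) (a * 2 ^ k + b) :: 'a mat)"
    and "j < dim_col (translation_mat (m + k) (a * 2 ^ k + b) :: 'a mat)"
  then have ij: "i < 2 ^ m * 2 ^ k" "j < 2 ^ m * 2 ^ k"
    by (simp_all add: power_add)
  have quot: "i div 2 ^ k < 2 ^ m" "j div 2 ^ k < 2 ^ m"
    using ij by (simp_all add: less_mult_imp_div_less)
  have "x div 2 ^ k = a \<and> x mod 2 ^ k = b \<longleftrightarrow> x = a * 2 ^ k + b" for x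
    using b div_mult_mod_eq[of x "2 ^ k"] by auto
  moreover have "xor (i div 2 ^ k) (j div 2 ^ k) = xor i j div 2 ^ k"
    "xor (i mod 2 ^ k) (j mod 2 ^ k) = xor i j mod 2 ^ k"
    by (simp_all flip: drop_bit_eq_div take_bit_eq_mod)
  ultimately have "xor (i div 2 ^ k) (j div 2 ^ k) = a \<and> xor (i mod 2 ^ k) (j mod 2 ^ k) = b
      \<longleftrightarrow> xor i j = a * 2 ^ k + b"
    by metis
  then show "kronecker (translation_mat m a) (translation_mat k b) $$ (i, j)
      = (translation_mat (m + k) (a * 2 ^ k + b) :: 'a mat) $$ (i, j)"
    using ij quot by (simp add: kronecker_def translation_mat_def power_add) metis
qed (simp_all add: kronecker_def power_add)

text \<open>For \<open>b = 1\<close> these are the powers of \<open>J2\<close>, for \<open>b = 0\<close> those of the identity.\<close>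

lemma kronecker_pow_translation_mat:
  assumes "b \<le> 1"
  shows "kronecker_pow (translation_mat 1 b) k
    = (translation_mat k (b * (2 ^ k - 1)) :: 'a::semiring_1 mat)"
proof (induction k)
  case 0
  show ?case by simp
next
  case (Suc k)
  have "b * (2 ^ k - 1) < 2 ^ k"
    using assms by (cases b) auto
  moreover have "b * 2 ^ k + b * (2 ^ k - 1) = b * (2 ^ Suc k - 1)"
    by (simp add: algebra_simps)
  ultimately show ?case
    using Suc by (simp add: kronecker_translation_mat)
qed

lemma J2_eq: "J2 = translation_mat 1 1"
  by (rule eq_matI)
    (auto simp: J2_def mat_of_rows_list_def translation_mat_def less_Suc_eq numeral_2_eq_2)

lemma J_eq:
  assumes "k \<le> n"
  shows "J n k = translation_mat n ((2 ^ k - 1) * 2 ^ (n - k))"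
proof -
  have one: "(1\<^sub>m 2 :: real mat) = translation_mat 1 0"
    by simp
  have "J n k = kronecker (translation_mat k (2 ^ k - 1)) (translation_mat (n - k) 0)"
    unfolding J_def J2_eq one
    using kronecker_pow_translation_mat[of 1 k, where 'a = real]
      kronecker_pow_translation_mat[of 0 "n - k", where 'a = real]
    by (simp del: translation_mat_0)
  also have "\<dots> = translation_mat n ((2 ^ k - 1) * 2 ^ (n - k))"
    using assms by (subst kronecker_translation_mat) simp_all
  finally show ?thesis .
qed

text \<open>
  The strings \<open>a\<close> whose translation commutes with \<open>A\<close> form a subgroup. It contains the strings with
  precisely the top \<open>k\<close> bits set, as \<open>J n k\<close> is an involution, and by induction on \<open>k\<close> every string
  supported on the top \<open>k\<close> bits.
\<close>

lemma Fix_Z2_commute_translation_mat: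
  assumes A: "A \<in> Fix_Z2 n" and "a < 2 ^ n"
  shows "translation_mat n a * A = A * translation_mat n a"
proof -
  have Ac: "A \<in> carrier_mat (2 ^ n) (2 ^ n)"
    using A by (simp add: Fix_Z2_def)
  note assoc = assoc_mult_mat[of _ "2 ^ n" "2 ^ n" _ "2 ^ n" _ "2 ^ n"]
  define H where
    "H = {a. a < 2 ^ n \<and> translation_mat n a * A = A * translation_mat n a}"
  have xor_H: "xor a b \<in> H" if "a \<in> H" "b \<in> H" for a b
  proof -
    have "translation_mat n (xor a b) * A = translation_mat n a * (translation_mat n b * A)"
      using that Ac by (simp add: H_def translation_mat_mult[symmetric] assoc)
    also have "\<dots> = (translation_mat n a * A) * translation_mat n b"
      using that Ac by (simp add: H_def assoc del: index_mult_mat) (simp add: assoc[symmetric])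
    also have "\<dots> = A * translation_mat n (xor a b)"
      using that Ac by (simp add: H_def translation_mat_mult[symmetric] assoc)
    finally show ?thesis
      using that by (simp add: H_def xor_less_power_two)
  qed
  have mask_H: "(2 ^ k - 1) * 2 ^ (n - k) \<in> H" if "k \<in> {1..n}" for k
  proof -
    have lt: "(2 ^ k - 1) * 2 ^ (n - k) < (2 ^ n :: nat)"
    proof -
      have "(2 ^ k - 1) * 2 ^ (n - k) < (2 ^ k * 2 ^ (n - k) :: nat)"
        by simp
      then show ?thesis
        using that by (simp flip: power_add)
    qed
    let ?T = "translation_mat n ((2 ^ k - 1) * 2 ^ (n - k)) :: real mat"
    have fixed: "?T * A * ?T = A"
      using A that by (auto simp: Fix_Z2_def J_eq)
    have "?T * A = ?T * A * (?T * ?T)"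
      using Ac lt by (simp add: translation_mat_square)
    also have "\<dots> = (?T * A * ?T) * ?T"
      using Ac by (simp add: assoc[OF mult_carrier_mat[OF translation_mat_carrier Ac]])
    finally show ?thesis
      using fixed lt by (simp add: H_def)
  qed
  have top_bits_H: "k \<le> n \<Longrightarrow> c < 2 ^ k \<Longrightarrow> c * 2 ^ (n - k) \<in> H" for k c
  proof (induction k arbitrary: c)
    case 0
    then show ?case
      using Ac by (simp add: H_def)
  next
    case (Suc k)
    \<comment> \<open>An even \<open>e\<close> leaves the lowest of the top \<open>Suc k\<close> bits clear, so only the top \<open>k\<close> matter.\<close>
    have even_H: "e * 2 ^ (n - Suc k) \<in> H" if "even e" "e < 2 ^ Suc k" for e
    proof -
      have "e * 2 ^ (n - Suc k) = (e div 2) * 2 ^ (n - k)"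
        using \<open>even e\<close> Suc.prems(1) by (auto elim!: evenE simp: Suc_diff_Suc simp flip: power_Suc)
      then show ?thesis
        using Suc.IH[of "e div 2"] Suc.prems(1) that(2) by auto
    qed
    show ?case
    proof (cases "even c")
      case True
      then show ?thesis
        using even_H Suc.prems by blast
    next
      case False
      \<comment> \<open>Adding the all-ones string to an odd \<open>c\<close> makes it even.\<close>
      define mask :: nat where "mask = 2 ^ Suc k - 1"
      have "even (xor c mask)"
        using False by (simp add: even_xor_iff mask_def)
      moreover have "xor c mask < 2 ^ Suc k"
        using Suc.prems by (intro xor_less_power_two) (simp_all add: mask_def)
      ultimately have "xor (xor c mask * 2 ^ (n - Suc k)) (mask * 2 ^ (n - Suc k)) \<in> H"
        using even_H mask_H[of "Suc k"] Suc.prems xor_H by (simp add: mask_def)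
      also have "xor (xor c mask * 2 ^ (n - Suc k)) (mask * 2 ^ (n - Suc k))
          = xor (xor c mask) mask * 2 ^ (n - Suc k)"
        by (simp flip: push_bit_eq_mult)
      also have "xor (xor c mask) mask = c"
        by (simp add: xor.assoc)
      finally show ?thesis .
    qed
  qed
  show ?thesis
    using top_bits_H[of n a] assms(2) by (simp add: H_def)
qed

section \<open>Positive definite square roots\<close>

lemma sym_pos_def_dim_eq: "sym_pos_def A \<Longrightarrow> dim_col A = dim_row A"
  unfolding sym_pos_def_def by (metis index_transpose_mat(2))

lemma sym_pos_def_quadratic_nonneg:
  assumes "sym_pos_def A" "A \<in> carrier_mat d d" "v \<in> carrier_vec d"
  shows "v \<bullet> (A *\<^sub>v v) \<ge> 0"
proof (cases "v = 0\<^sub>v d")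
  case True
  then show ?thesis
    using assms by (simp add: scalar_prod_def)
next
  case False
  then show ?thesis
    using assms by (auto simp: sym_pos_def_def intro: less_imp_le)
qed

text \<open>
  Positivity of the inverse \<open>B\<close> at \<open>v\<close> is positivity of \<open>A\<close> at \<open>w = B v\<close>, since
  \<open>v \<bullet> B v = A w \<bullet> w\<close>.
\<close>

lemma sym_pos_def_inverse:
  assumes A: "sym_pos_def A" "A \<in> carrier_mat d d"
  obtains B where "mat_inverse A = Some B" "B \<in> carrier_mat d d" "sym_pos_def B"
    "A * B = 1\<^sub>m d" "B * A = 1\<^sub>m d"
proof -
  have "det A \<noteq> 0"
  proof
    assume "det A = 0"
    then obtain v where "v \<in> carrier_vec d" "v \<noteq> 0\<^sub>v d" "A *\<^sub>v v = 0\<^sub>v d"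
      using det_0_iff_vec_prod_zero[OF A(2)] by blast
    then show False
      using A by (auto simp: sym_pos_def_def)
  qed
  then have "mat_inverse A \<noteq> None"
    using mat_inverse(1)[OF A(2), where b = "()"] det_non_zero_imp_unit[OF A(2), where b = "()"]
    by blast
  then obtain B where inv: "mat_inverse A = Some B"
    and B: "B \<in> carrier_mat d d" "A * B = 1\<^sub>m d" "B * A = 1\<^sub>m d"
    using mat_inverse(2)[OF A(2)] by blast
  have A_sym: "transpose_mat A = A"
    using A by (simp add: sym_pos_def_def)
  have "transpose_mat B = transpose_mat B * (A * B)"
    using B by simp
  also have "\<dots> = transpose_mat (A * B) * B"
    using A A_sym B(1) transpose_mult[OF A(2) B(1)] by (simp add: assoc_mult_mat[of _ d d _ d _ d])
  also have "\<dots> = B"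
    using B by simp
  finally have B_sym: "transpose_mat B = B" .
  have "v \<bullet> (B *\<^sub>v v) > 0" if v: "v \<in> carrier_vec d" "v \<noteq> 0\<^sub>v d" for v
  proof -
    define w where "w = B *\<^sub>v v"
    have w: "w \<in> carrier_vec d"
      using B v by (simp add: w_def)
    have Aw: "A *\<^sub>v w = v"
      using A B v by (simp add: w_def flip: assoc_mult_mat_vec[of A d d B d])
    have "w \<noteq> 0\<^sub>v d"
      using Aw A v by auto
    then have "w \<bullet> (A *\<^sub>v w) > 0"
      using A w by (auto simp: sym_pos_def_def)
    then show ?thesis
      using Aw w v comm_scalar_prod[of w d v] by (simp add: w_def)
  qed
  then have "sym_pos_def B"
    using B(1) B_sym by (simp add: sym_pos_def_def)
  with inv B that show ?thesis
    by blast
qed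

text \<open>
  With \<open>D = B - C\<close>, the equation \<open>B\<^sup>2 = C\<^sup>2\<close> says \<open>B D = - D C\<close>. Taking traces,
  \<open>tr (D B D) = - tr (D C D)\<close>. Both \<open>D B D\<close> and \<open>D C D\<close> have nonnegative diagonal entries, the
  values of the forms \<open>B\<close> and \<open>C\<close> at the columns of \<open>D\<close>; so these values vanish, and
  definiteness forces \<open>D = 0\<close>.
\<close>

lemma sym_pos_def_root_unique:
  assumes B: "B \<in> carrier_mat d d" "sym_pos_def B"
    and C: "C \<in> carrier_mat d d" "sym_pos_def C"
    and eq: "B * B = C * C"
  shows "B = C"
proof -
  define D where "D = B - C"
  have D: "D \<in> carrier_mat d d"
    using B C by (simp add: D_def minus_carrier_mat)
  have "transpose_mat D = D"
    using B C by (auto simp: D_def sym_pos_def_def transpose_minus)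
  then have D_row: "row D i = col D i" if "i < d" for i
    using D that by (metis carrier_matD(1) col_transpose)
  have BD: "B * D = - (D * C)"
  proof -
    have "B * D = B * B - B * C"
      using B C by (simp add: D_def mult_minus_distrib_mat[of _ d d])
    moreover have "D * C = B * C - C * C"
      using B C by (simp add: D_def minus_mult_distrib_mat[of _ d d])
    ultimately show ?thesis
      using B C eq by (intro eq_matI) (simp_all)
  qed
  have form: "col D i \<bullet> (E *\<^sub>v col D i) = (D * (E * D)) $$ (i, i)"
    if "i < d" "E \<in> carrier_mat d d" for i E
    using D D_row that by (simp add: mult_mat_vec_def)
  have trace_comm: "(\<Sum>i<d. (D * E) $$ (i, i)) = (\<Sum>i<d. (E * D) $$ (i, i))"
    if E: "E \<in> carrier_mat d d" for E
  proof -
    have "(\<Sum>i<d. (D * E) $$ (i, i)) = (\<Sum>i<d. \<Sum>j<d. D $$ (i, j) * E $$ (j, i))"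
      using D E by (simp add: scalar_prod_def lessThan_atLeast0)
    also have "\<dots> = (\<Sum>j<d. \<Sum>i<d. D $$ (i, j) * E $$ (j, i))"
      by (rule sum.swap)
    also have "\<dots> = (\<Sum>j<d. (E * D) $$ (j, j))"
      using D E by (simp add: scalar_prod_def lessThan_atLeast0 mult.commute)
    finally show ?thesis .
  qed
  have "(\<Sum>i<d. col D i \<bullet> (B *\<^sub>v col D i)) = (\<Sum>i<d. (D * (B * D)) $$ (i, i))"
    using form B(1) by simp
  also have "\<dots> = (\<Sum>i<d. (B * D * D) $$ (i, i))"
    using B D by (intro trace_comm) auto
  also have "B * D * D = - (D * (C * D))"
    using C D uminus_mult_left_mat[of "D * C" D] by (simp add: BD assoc_mult_mat[of D d d C d D d])
  also have "(\<Sum>i<d. (- (D * (C * D))) $$ (i, i)) = (\<Sum>i<d. - (D * (C * D)) $$ (i, i))"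
    using C D by (intro sum.cong) auto
  also have "\<dots> = - (\<Sum>i<d. col D i \<bullet> (C *\<^sub>v col D i))"
    using form C(1) by (simp add: sum_negf)
  finally have "(\<Sum>i<d. col D i \<bullet> (B *\<^sub>v col D i)) \<le> 0"
    using sum_nonneg[of "{..<d}" "\<lambda>i. col D i \<bullet> (C *\<^sub>v col D i)"] D
      sym_pos_def_quadratic_nonneg[OF C(2,1)] by fastforce
  moreover have nonneg: "col D i \<bullet> (B *\<^sub>v col D i) \<ge> 0" if "i < d" for i
    using sym_pos_def_quadratic_nonneg[OF B(2,1)] D that by auto
  ultimately have "col D i \<bullet> (B *\<^sub>v col D i) = 0" if "i < d" for i
    using that sum_nonneg_eq_0_iff[of "{..<d}" "\<lambda>i. col D i \<bullet> (B *\<^sub>v col D i)"]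
    by (metis (no_types, lifting) finite_lessThan lessThan_iff order_antisym sum_nonneg)
  then have col_0: "col D i = 0\<^sub>v d" if "i < d" for i
    using that B D by (metis carrier_matD(1) carrier_vecI col_dim less_irrefl sym_pos_def_def)
  show ?thesis
  proof (rule eq_matI)
    fix i j
    assume "i < dim_row C" "j < dim_col C"
    then have ij: "i < d" "j < d"
      using C by simp_all
    then have "D $$ (i, j) = 0"
      using col_0[of j] D by (metis carrier_matD index_col index_zero_vec(1))
    then show "B $$ (i, j) = C $$ (i, j)"
      using B C ij by (simp add: D_def)
  qed (use B C in simp_all)
qed

lemma mat_sqrt_eq:
  assumes "B \<in> carrier_mat d d" "sym_pos_def B" "B * B = A"
  shows "mat_sqrt A = B"
  unfolding mat_sqrt_def
proof (rule the_equality)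
  fix C
  assume C: "sym_pos_def C \<and> C * C = A"
  then have "C \<in> carrier_mat d d"
    using assms sym_pos_def_dim_eq[of C] by (metis carrier_matD(1) carrier_matI index_mult_mat(2))
  then show "C = B"
    using sym_pos_def_root_unique[of C d B] assms C by simp
qed (use assms in simp)

lemma root_of_inverse:
  assumes A: "A \<in> carrier_mat d d" and A': "A' \<in> carrier_mat d d"
    and inv: "A * A' = 1\<^sub>m d"
    and B: "sym_pos_def B" "B * B = A"
  obtains B' where "B' \<in> carrier_mat d d" "sym_pos_def B'" "B' * B' = A'"
    "B * B' = 1\<^sub>m d" "B' * B = 1\<^sub>m d"
proof -
  have Bc: "B \<in> carrier_mat d d"
    using A B sym_pos_def_dim_eq[of B] by (metis carrier_matD(1) carrier_matI index_mult_mat(2))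
  obtain B' where B': "B' \<in> carrier_mat d d" "sym_pos_def B'" "B * B' = 1\<^sub>m d" "B' * B = 1\<^sub>m d"
    using sym_pos_def_inverse[OF B(1) Bc] by metis
  note assoc = assoc_mult_mat[of _ d d _ d _ d]
  have "B' * B' = B' * (B' * (A * A'))"
    using B' inv by simp
  also have "\<dots> = B' * ((B' * B) * (B * A'))"
    using Bc B'(1) A' unfolding B(2)[symmetric] by (simp only: assoc mult_carrier_mat)
  also have "\<dots> = B' * (B * A')"
    using Bc B'(1) A' by (simp add: B'(4) left_mult_one_mat[OF mult_carrier_mat[OF Bc A']])
  also have "\<dots> = (B' * B) * A'"
    using Bc B'(1) A' by (simp only: assoc)
  also have "\<dots> = A'"
    using A' B'(4) by simp
  finally show ?thesis
    using that B' by blast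
qed

lemma commute_inverse:
  fixes B :: "'a::semiring_1 mat"
  assumes c: "B \<in> carrier_mat d d" "B' \<in> carrier_mat d d" "T \<in> carrier_mat d d"
    and inv: "B * B' = 1\<^sub>m d" "B' * B = 1\<^sub>m d"
    and comm: "T * B = B * T"
  shows "T * B' = B' * T"
proof -
  note assoc = assoc_mult_mat[of _ d d _ d _ d]
  have "T * B' = B' * B * (T * B')"
    using c inv by simp
  also have "\<dots> = B' * (B * T) * B'"
    using c by (simp add: assoc)
  also have "\<dots> = B' * T * (B * B')"
    using c by (simp add: comm[symmetric] assoc)
  also have "\<dots> = B' * T"
    using c inv by simp
  finally show ?thesis .
qed

text \<open>
  Inversion is a bijection between the positive definite roots of \<open>A\<close> and those of its inverse, so
  either both matrices have one or neither does. In the first case the two values of \<open>mat_sqrt\<close> are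
  inverse to each other, and a matrix that commutes with one commutes with the other.
\<close>

lemma mat_sqrt_inverse_commute:
  assumes A: "A \<in> carrier_mat d d" and A': "A' \<in> carrier_mat d d"
    and inv: "A * A' = 1\<^sub>m d" "A' * A = 1\<^sub>m d"
    and T: "T \<in> carrier_mat d d"
    and S: "mat_sqrt A \<in> carrier_mat d d"
    and comm: "T * mat_sqrt A = mat_sqrt A * T"
  shows "mat_sqrt A' \<in> carrier_mat d d \<and> T * mat_sqrt A' = mat_sqrt A' * T"
proof (cases "\<exists>B. sym_pos_def B \<and> B * B = A")
  case True
  then obtain B where B: "sym_pos_def B" "B * B = A"
    by blast
  then have "B \<in> carrier_mat d d"
    using A sym_pos_def_dim_eq[of B] by (metis carrier_matD(1) carrier_matI index_mult_mat(2))
  then have B_eq: "mat_sqrt A = B"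
    using B by (intro mat_sqrt_eq)
  obtain B' where B': "B' \<in> carrier_mat d d" "sym_pos_def B'" "B' * B' = A'"
    "B * B' = 1\<^sub>m d" "B' * B = 1\<^sub>m d"
    using root_of_inverse[OF A A' inv(1) B] .
  have "mat_sqrt A' = B'"
    using B' by (intro mat_sqrt_eq)
  then show ?thesis
    using B' B_eq S T comm commute_inverse[of B d B' T] by simp
next
  case False
  have "\<not> (\<exists>B. sym_pos_def B \<and> B * B = A')"
    using root_of_inverse[OF A' A inv(2)] False by metis
  \<comment> \<open>Both sides are descriptions by an unsatisfiable property, hence the same default value.\<close>
  with False have "mat_sqrt A' = mat_sqrt A"
    unfolding mat_sqrt_def by metis
  then show ?thesis
    using S comm by simp
qed

section \<open>The symmetries\<close>

definition doubled_translation :: "nat \<Rightarrow> nat \<Rightarrow> real mat" where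
  "doubled_translation n a = four_block_mat (translation_mat n a) (0\<^sub>m (2 ^ n) (2 ^ n))
     (0\<^sub>m (2 ^ n) (2 ^ n)) (translation_mat n a)"

lemma doubled_translation_carrier [simp]:
  "doubled_translation n a \<in> carrier_mat (2 * 2 ^ n) (2 * 2 ^ n)"
  by (simp add: doubled_translation_def carrier_matI)

lemma doubled_translation_column_0:
  assumes "i < 2 ^ n"
  shows "doubled_translation n a $$ (i, 0) = (if i = a then 1 else 0)"
  using assms by (simp add: doubled_translation_def translation_mat_column_0)

lemma transpose_doubled_translation [simp]:
  "transpose_mat (doubled_translation n a) = doubled_translation n a"
  by (simp add: doubled_translation_def
      transpose_four_block_mat[of _ "2 ^ n" "2 ^ n" _ "2 ^ n" _ "2 ^ n"])

lemma doubled_translation_square: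
  assumes "a < 2 ^ n"
  shows "doubled_translation n a * doubled_translation n a = 1\<^sub>m (2 * 2 ^ n)"
proof -
  have "doubled_translation n a * doubled_translation n a
      = four_block_mat (1\<^sub>m (2 ^ n)) (0\<^sub>m (2 ^ n) (2 ^ n)) (0\<^sub>m (2 ^ n) (2 ^ n)) (1\<^sub>m (2 ^ n))"
    unfolding doubled_translation_def
    by (subst mult_four_block_mat[of _ "2 ^ n" "2 ^ n" _ "2 ^ n" _ "2 ^ n" _ _ "2 ^ n" _ "2 ^ n"])
      (simp_all add: translation_mat_square assms)
  then show ?thesis
    by (simp add: mult_2)
qed

lemma inj_doubled_translation: "inj_on (doubled_translation n) {..<2 ^ n}"
proof (rule inj_onI)
  fix a b :: nat
  assume "a \<in> {..<2 ^ n}" and eq: "doubled_translation n a = doubled_translation n b"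
  then have "a < 2 ^ n" by simp
  from doubled_translation_column_0[OF this, of a] doubled_translation_column_0[OF this, of b]
  show "a = b"
    using eq by (simp split: if_splits)
qed

text \<open>
  An integer matrix maps integer vectors to integer vectors; here it is its own inverse, so every
  integer vector is attained.
\<close>

lemma doubled_translation_int_vecs:
  assumes a: "a < 2 ^ n"
  shows "(\<lambda>v. doubled_translation n a *\<^sub>v v) ` int_vecs (2 * 2 ^ n) = int_vecs (2 * 2 ^ n)"
proof -
  let ?U = "doubled_translation n a"
  have entries: "?U $$ (i, j) \<in> \<int>" if "i < 2 * 2 ^ n" "j < 2 * 2 ^ n" for i j
    using that by (auto simp: doubled_translation_def translation_mat_def)
  have maps: "?U *\<^sub>v v \<in> int_vecs (2 * 2 ^ n)" if "v \<in> int_vecs (2 * 2 ^ n)" for v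
  proof -
    have v: "v \<in> carrier_vec (2 * 2 ^ n)" "\<And>i. i < 2 * 2 ^ n \<Longrightarrow> v $ i \<in> \<int>"
      using that by (auto simp: int_vecs_def)
    have "(?U *\<^sub>v v) $ i \<in> \<int>" if "i < 2 * 2 ^ n" for i
      using that v entries carrier_matD[OF doubled_translation_carrier[of n a]]
      by (auto simp: scalar_prod_def intro!: Ints_sum Ints_mult)
    then show ?thesis
      using v(1) mult_mat_vec_carrier[OF doubled_translation_carrier] by (auto simp: int_vecs_def)
  qed
  have involution: "?U *\<^sub>v (?U *\<^sub>v v) = v" if "v \<in> int_vecs (2 * 2 ^ n)" for v
    using that doubled_translation_square[OF a]
      assoc_mult_mat_vec[OF doubled_translation_carrier doubled_translation_carrier, of v n a a]
    by (simp add: int_vecs_def)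
  show ?thesis
  proof (intro equalityI subsetI)
    fix v
    assume "v \<in> int_vecs (2 * 2 ^ n)"
    then show "v \<in> (\<lambda>v. ?U *\<^sub>v v) ` int_vecs (2 * 2 ^ n)"
      using maps involution by (intro image_eqI[of _ _ "?U *\<^sub>v v"]) simp_all
  qed (use maps in blast)
qed

text \<open>
  All blocks of the two factors of \<open>P_mat Z\<close>, namely \<open>0\<close>, \<open>1\<close>, \<open>X\<close> and the roots of \<open>Y\<close> and of its
  inverse, commute with the translation, so the factors commute with its double.
\<close>

lemma doubled_translation_commute_P_mat:
  assumes Z: "Z \<in> A_s n" and a: "a < 2 ^ n"
  shows "doubled_translation n a * P_mat Z = P_mat Z * doubled_translation n a"
    and "P_mat Z \<in> carrier_mat (2 * 2 ^ n) (2 * 2 ^ n)"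
proof -
  let ?g = "2 ^ n :: nat"
  let ?T = "translation_mat n a :: real mat"
  define X where "X = map_mat Re Z"
  define Y where "Y = map_mat Im Z"
  obtain X0 Y0 where Z_eq: "Z = map_mat complex_of_real X0 + \<i> \<cdot>\<^sub>m map_mat complex_of_real Y0"
    and XY0: "X0 \<in> carrier_mat ?g ?g" "Y0 \<in> carrier_mat ?g ?g" "sym_pos_def Y0"
    using Z by (auto simp: A_s_def siegel_space_def)
  have "Y = Y0"
    using XY0 by (intro eq_matI) (auto simp: Y_def Z_eq)
  then have Y: "Y \<in> carrier_mat ?g ?g" "sym_pos_def Y"
    using XY0 by simp_all
  have dim_Z: "dim_row Z = ?g"
    using XY0 by (simp add: Z_eq)
  have Fix: "mat_sqrt Y \<in> Fix_Z2 n" "X \<in> Fix_Z2 n"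
    using Z by (simp_all add: A_s_def X_def Y_def)
  then have c: "mat_sqrt Y \<in> carrier_mat ?g ?g" "X \<in> carrier_mat ?g ?g"
    by (simp_all add: Fix_Z2_def)
  have comm: "?T * mat_sqrt Y = mat_sqrt Y * ?T" "?T * X = X * ?T"
    using Fix a by (simp_all add: Fix_Z2_commute_translation_mat)
  define Y' where "Y' = the (mat_inverse Y)"
  have "mat_inverse Y = Some Y'"
    using sym_pos_def_inverse[OF Y(2,1)] by (metis Y'_def option.sel)
  then have Y': "Y' \<in> carrier_mat ?g ?g" "Y * Y' = 1\<^sub>m ?g" "Y' * Y = 1\<^sub>m ?g"
    using mat_inverse(2)[OF Y(1)] by blast+
  define R where "R = mat_sqrt Y'"
  have R: "R \<in> carrier_mat ?g ?g" "?T * R = R * ?T"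
    using mat_sqrt_inverse_commute[OF Y(1) Y' translation_mat_carrier c(1) comm(1)]
    by (simp_all add: R_def)
  have P: "P_mat Z = four_block_mat R (0\<^sub>m ?g ?g) (0\<^sub>m ?g ?g) (mat_sqrt Y)
      * four_block_mat (1\<^sub>m ?g) X (0\<^sub>m ?g ?g) (1\<^sub>m ?g)" (is "_ = ?D * ?N")
    by (simp add: P_mat_def Let_def dim_Z R_def Y'_def Y_def X_def)
  let ?U = "doubled_translation n a"
  have D: "?D \<in> carrier_mat (2 * ?g) (2 * ?g)" and N: "?N \<in> carrier_mat (2 * ?g) (2 * ?g)"
    unfolding mult_2 using R(1) c by (auto intro!: four_block_carrier_mat)
  show "P_mat Z \<in> carrier_mat (2 * ?g) (2 * ?g)"
    unfolding P using D N by (rule mult_carrier_mat)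
  note block_mult = mult_four_block_mat[of _ ?g ?g _ ?g _ ?g _ _ ?g _ ?g]
  have UD: "?U * ?D = ?D * ?U"
    unfolding doubled_translation_def
    by (subst (1 2) block_mult) (use R c comm in \<open>simp_all\<close>)
  have UN: "?U * ?N = ?N * ?U"
    unfolding doubled_translation_def
    by (subst (1 2) block_mult) (use c comm in \<open>simp_all\<close>)
  note assoc = assoc_mult_mat[of _ "2 * ?g" "2 * ?g" _ "2 * ?g" _ "2 * ?g"]
  have "?U * (?D * ?N) = (?U * ?D) * ?N"
    using D N by (simp add: assoc)
  also have "\<dots> = ?D * (?U * ?N)"
    using D N by (simp add: UD assoc)
  also have "\<dots> = (?D * ?N) * ?U"
    using D N by (simp add: UN assoc)
  finally show "?U * P_mat Z = P_mat Z * ?U"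
    by (simp add: P)
qed

lemma doubled_translation_lattice:
  assumes Z: "Z \<in> A_s n" and a: "a < 2 ^ n"
  shows "(\<lambda>v. doubled_translation n a *\<^sub>v v) ` symplectic_lattice Z = symplectic_lattice Z"
proof -
  let ?U = "doubled_translation n a" and ?L = "int_vecs (2 * 2 ^ n)"
  note P = doubled_translation_commute_P_mat[OF Z a]
  have "dim_row Z = 2 ^ n"
    using Z by (auto simp: A_s_def siegel_space_def)
  then have L: "symplectic_lattice Z = (\<lambda>v. P_mat Z *\<^sub>v v) ` ?L"
    by (simp add: symplectic_lattice_def)
  have "?U *\<^sub>v (P_mat Z *\<^sub>v v) = P_mat Z *\<^sub>v (?U *\<^sub>v v)" if "v \<in> ?L" for v
  proof -
    have "v \<in> carrier_vec (2 * 2 ^ n)"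
      using that by (simp add: int_vecs_def)
    then show ?thesis
      using P(1) assoc_mult_mat_vec[OF doubled_translation_carrier P(2)]
        assoc_mult_mat_vec[OF P(2) doubled_translation_carrier]
      by metis
  qed
  then have "(\<lambda>v. ?U *\<^sub>v v) ` symplectic_lattice Z = (\<lambda>v. P_mat Z *\<^sub>v v) ` (\<lambda>v. ?U *\<^sub>v v) ` ?L"
    unfolding L image_image by (intro image_cong refl)
  then show ?thesis
    by (simp add: doubled_translation_int_vecs[OF a] L)
qed

lemma doubled_translation_symmetry:
  assumes Z: "Z \<in> A_s n" and a: "0 < a" "a < 2 ^ n"
  shows "doubled_translation n a \<in> lattice_symmetries (2 * 2 ^ n) (symplectic_lattice Z)"
proof -
  have "doubled_translation n a $$ (0, 0) = 0"
    using a by (simp add: doubled_translation_column_0)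
  then have "doubled_translation n a \<noteq> 1\<^sub>m (2 * 2 ^ n)"
    and "doubled_translation n a \<noteq> - 1\<^sub>m (2 * 2 ^ n)"
    by auto
  then show ?thesis
    using a doubled_translation_lattice[OF Z a(2)]
    by (simp add: lattice_symmetries_def doubled_translation_square)
qed

theorem theorem2p4:
  fixes n g :: nat and Z :: "complex mat"
  assumes "n \<ge> 1"
    and "g = 2 ^ n"
    and "Z \<in> A_s n"
  shows "\<exists>S \<subseteq> lattice_symmetries (2 * g) (symplectic_lattice Z). finite S \<and> card S \<ge> g - 1"
proof (intro exI conjI)
  let ?S = "doubled_translation n ` {1..<2 ^ n}"
  show "?S \<subseteq> lattice_symmetries (2 * g) (symplectic_lattice Z)"
    using doubled_translation_symmetry[OF assms(3)] assms(2) by auto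
  show "finite ?S"
    by simp
  have "inj_on (doubled_translation n) {1..<2 ^ n}"
    by (rule inj_on_subset[OF inj_doubled_translation]) auto
  then show "card ?S \<ge> g - 1"
    using assms(2) by (simp add: card_image)
qed

end
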